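(* Let $n\le\infty$ and let $\left(X=\prod_{k=1}^{n-1}Y,\ \mu=\prod_{k=1}^{n-1}\mu_k\right)$ be a product measure space, where each $\mu_k$ is a measure on $Y$ giving positive measure to every point and, if $n=\infty$, $\mu_k(Y)=1$ for all $k$. Let $\pi$ be an action of the braid group $\mathbb{B}_n$ on $X$, write $\pi_k=\pi(\tau_k)$, and assume that each $\pi_k$ maps cylindrical sets to cylindrical sets. If $Y=\{a^1,\dots,a^t\}$ is a finite set and each $\pi_k$ acts changing only finitely many coordinates $x_j$ of $x$, then $\mu$ is $\pi$-quasi-invariant.
   Context: $\mathbb{B}_n$ is the braid group with generators $\tau_1,\dots,\tau_{n-1}$ and relations $\tau_k\tau_j=\tau_j\tau_k$ if $|k-j|>1$, $\tau_k\tau_{k+1}\tau_k=\tau_{k+1}\tau_k\tau_{k+1}$ for $1\le k\le n-2$; $\mathbb{B}_\infty$ has generators $\tau_1,\tau_2,\dots$ and the same relations. When $n=\infty$, products over $k=1,\dots,n-1$ are over all $k\ge1$. $X$ carries the $\sigma$-algebra of Borel subsets generated by the cylindrical sets $X(a_{i_1},\dots,a_{i_r})=\{(x_1,\dots,x_{n-1}):x_{i_j}=a_{i_j},\ j=1,\dots,r\}$, $a_{i_j}\in Y$, $r<\infty$, and $\mu$ is the product measure, determined (for probability measures $\mu_k$) by $\mu(X(a_{i_1},\dots,a_{i_r}))=\prod_{j=1}^r\mu_{i_j}(a_{i_j})>0$; for finite products the normalization $\mu_k(Y)=1$ is not required. That $\pi_k$ maps cylindrical sets to cylindrical sets means that $\pi_k(X(a_{i_1},\dots,a_{i_r}))$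 is always of the form $X(b_{j_1},\dots,b_{j_s})$. An action of $\mathbb{B}_n$ on $X$ is a map $\pi:\mathbb{B}_n\times X\to X$ such that each $\pi(g)$ is a continuous function (for the product topology on $X$, with $Y$ discrete), $\pi(gh)=\pi(g)\pi(h)$ for all $g,h$, and $\pi(1)$ is the identity. "$\pi_k$ changes only finitely many coordinates" means that there is a finite set $J_k$ of indices (depending only on $k$) such that $(\pi_kx)_j=x_j$ for all $x\in X$ and $j\notin J_k$. The measure $\mu$ is $\pi$-quasi-invariant if for all $g\in\mathbb{B}_n$: $\mu(E)=0$ if and only if $\mu(\pi(g)E)=0$. *)

theory Defs
  imports "HOL-Analysis.Analysis" "HOL-Algebra.Group" "HOL-Library.Extended_Nat"
begin

section \<open>The braid group\<close>

text \<open>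
  The index set \<open>{1, \<dots>, n - 1}\<close>, which is \<open>{1, 2, \<dots>}\<close> for \<open>n = \<infinity>\<close>. It indexes both the
  generators of the braid group and the coordinates of the product space.
\<close>

definition braid_index :: "enat \<Rightarrow> nat set" where
  "braid_index n = {k. 1 \<le> k \<and> enat k < n}"

text \<open>
  The group is given by its presentation: it consists of the words in the letters \<open>(k, True)\<close>,
  standing for the \<open>k\<close>-th generator, and \<open>(k, False)\<close>, standing for its inverse, modulo the least
  congruence that contains the free cancellations and the braid relations.
\<close>

type_synonym braid_word = "(nat \<times> bool) list"

definition braid_words :: "enat \<Rightarrow> braid_word set" where
  "braid_words n = lists (braid_index n \<times> UNIV)"

inductive braid_eq :: "enat \<Rightarrow> braid_word \<Rightarrow> braid_word \<Rightarrow> bool" for n where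
  refl: "w \<in> braid_words n \<Longrightarrow> braid_eq n w w"
| sym: "braid_eq n u v \<Longrightarrow> braid_eq n v u"
| trans: "braid_eq n u v \<Longrightarrow> braid_eq n v w \<Longrightarrow> braid_eq n u w"
| append: "braid_eq n u u' \<Longrightarrow> braid_eq n v v' \<Longrightarrow> braid_eq n (u @ v) (u' @ v')"
| cancel: "k \<in> braid_index n \<Longrightarrow> braid_eq n [(k, b), (k, \<not> b)] []"
| far: "k \<in> braid_index n \<Longrightarrow> j \<in> braid_index n \<Longrightarrow> \<bar>int k - int j\<bar> > 1 \<Longrightarrow>
    braid_eq n [(k, True), (j, True)] [(j, True), (k, True)]"
| braid: "k \<in> braid_index n \<Longrightarrow> Suc k \<in> braid_index n \<Longrightarrow>
    braid_eq n [(k, True), (Suc k, True), (k, True)] [(Suc k, True), (k, True), (Suc k, True)]"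

definition braid_class :: "enat \<Rightarrow> braid_word \<Rightarrow> braid_word set" where
  "braid_class n w = {v. braid_eq n w v}"

definition braid_group :: "enat \<Rightarrow> braid_word set monoid" where
  "braid_group n =
    \<lparr>carrier = braid_class n ` braid_words n,
     monoid.mult = (\<lambda>A B. {w. \<exists>u\<in>A. \<exists>v\<in>B. braid_eq n (u @ v) w}),
     one = braid_class n []\<rparr>"

definition braid_gen :: "enat \<Rightarrow> nat \<Rightarrow> braid_word set" where
  "braid_gen n k = braid_class n [(k, True)]"

lemma Nil_braid_words: "[] \<in> braid_words n"
  by (simp add: braid_words_def)

lemma append_braid_words:
  "u @ v \<in> braid_words n \<longleftrightarrow> u \<in> braid_words n \<and> v \<in> braid_words n"
  by (simp add: braid_words_def)

lemma braid_eq_words: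
  "braid_eq n u v \<Longrightarrow> u \<in> braid_words n \<and> v \<in> braid_words n"
  by (induction rule: braid_eq.induct) (auto simp: braid_words_def)

lemma braid_class_eq_iff:
  assumes "u \<in> braid_words n"
  shows "braid_class n u = braid_class n v \<longleftrightarrow> braid_eq n u v"
  using assms unfolding braid_class_def
  by (auto intro: braid_eq.refl braid_eq.sym braid_eq.trans dest: braid_eq_words)

lemma carrier_braid_group: "carrier (braid_group n) = braid_class n ` braid_words n"
  by (simp add: braid_group_def)

lemma one_braid_group: "\<one>\<^bsub>braid_group n\<^esub> = braid_class n []"
  by (simp add: braid_group_def)

lemma mult_braid_group:
  assumes "u \<in> braid_words n" "v \<in> braid_words n"
  shows "braid_class n u \<otimes>\<^bsub>braid_group n\<^esub> braid_class n v = braid_class n (u @ v)"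
  using assms unfolding braid_group_def braid_class_def
  by (auto intro: braid_eq.refl braid_eq.append braid_eq.trans)

lemma braid_eq_inverse:
  assumes "w \<in> braid_words n"
  shows "braid_eq n (rev (map (\<lambda>(k, b). (k, \<not> b)) w) @ w) []"
  using assms
proof (induction w)
  case Nil
  then show ?case by (simp add: braid_eq.refl)
next
  case (Cons x w)
  obtain k b where x: "x = (k, b)" by (cases x)
  let ?i = "rev (map (\<lambda>(k, b). (k, \<not> b)) w)"
  have k: "k \<in> braid_index n" and w: "w \<in> braid_words n"
    using Cons.prems x by (auto simp: braid_words_def)
  have i: "?i \<in> braid_words n"
    using w by (auto simp: braid_words_def in_lists_conv_set)
  have "braid_eq n ([(k, \<not> b), (k, b)] @ w) ([] @ w)"
    using braid_eq.append[OF braid_eq.cancel[OF k, of "\<not> b"] braid_eq.refl[OF w]] by simp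
  then have "braid_eq n (?i @ ([(k, \<not> b), (k, b)] @ w)) (?i @ ([] @ w))"
    by (rule braid_eq.append[OF braid_eq.refl[OF i]])
  then show ?case
    using braid_eq.trans Cons.IH[OF w] x by fastforce
qed

lemma group_braid_group: "group (braid_group n)"
proof (rule groupI)
  fix A assume "A \<in> carrier (braid_group n)"
  then obtain w where w: "w \<in> braid_words n" "A = braid_class n w"
    by (auto simp: carrier_braid_group)
  let ?i = "rev (map (\<lambda>(k, b). (k, \<not> b)) w)"
  have i: "?i \<in> braid_words n"
    using w by (auto simp: braid_words_def in_lists_conv_set)
  have "braid_class n (?i @ w) = braid_class n []"
    using braid_eq_inverse[OF w(1)] braid_class_eq_iff braid_eq_words by blast
  then show "\<exists>B\<in>carrier (braid_group n). B \<otimes>\<^bsub>braid_group n\<^esub> A = \<one>\<^bsub>braid_group n\<^esub>"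
    using i w by (auto simp: carrier_braid_group one_braid_group mult_braid_group)
qed (auto simp: carrier_braid_group one_braid_group mult_braid_group append_braid_words
    Nil_braid_words)

lemma braid_gen_closed: "k \<in> braid_index n \<Longrightarrow> braid_gen n k \<in> carrier (braid_group n)"
  by (auto simp: braid_gen_def carrier_braid_group braid_words_def)


section \<open>The product space\<close>

definition braid_space :: "enat \<Rightarrow> 'y set \<Rightarrow> (nat \<Rightarrow> 'y) set" where
  "braid_space n Y = (\<Pi>\<^sub>E k\<in>braid_index n. Y)"

definition braid_topology :: "enat \<Rightarrow> 'y set \<Rightarrow> (nat \<Rightarrow> 'y) topology" where
  "braid_topology n Y = product_topology (\<lambda>_. discrete_topology Y) (braid_index n)"

definition cylinder :: "enat \<Rightarrow> 'y set \<Rightarrow> nat set \<Rightarrow> (nat \<Rightarrow> 'y) \<Rightarrow> (nat \<Rightarrow> 'y) set" where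
  "cylinder n Y J a = {x \<in> braid_space n Y. \<forall>j\<in>J. x j = a j}"

definition cylinders :: "enat \<Rightarrow> 'y set \<Rightarrow> (nat \<Rightarrow> 'y) set set" where
  "cylinders n Y = {cylinder n Y J a | J a. finite J \<and> J \<subseteq> braid_index n \<and> a \<in> J \<rightarrow> Y}"


section \<open>Actions and quasi-invariance\<close>

definition braid_action ::
  "enat \<Rightarrow> 'y set \<Rightarrow> (braid_word set \<Rightarrow> (nat \<Rightarrow> 'y) \<Rightarrow> (nat \<Rightarrow> 'y)) \<Rightarrow> bool" where
  "braid_action n Y \<pi> \<longleftrightarrow>
    (\<forall>g\<in>carrier (braid_group n).
      continuous_map (braid_topology n Y) (braid_topology n Y) (\<pi> g)) \<and>
    (\<forall>g\<in>carrier (braid_group n). \<forall>h\<in>carrier (braid_group n). \<forall>x\<in>braid_space n Y.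
      \<pi> (g \<otimes>\<^bsub>braid_group n\<^esub> h) x = \<pi> g (\<pi> h x)) \<and>
    (\<forall>x\<in>braid_space n Y. \<pi> \<one>\<^bsub>braid_group n\<^esub> x = x)"

text \<open>
  Since \<^const>\<open>emeasure\<close> is \<open>0\<close> on non-measurable sets, the measurability of the image, which is
  implicit in speaking of its measure, is spelled out.
\<close>

definition quasi_invariant ::
  "enat \<Rightarrow> (braid_word set \<Rightarrow> (nat \<Rightarrow> 'y) \<Rightarrow> (nat \<Rightarrow> 'y)) \<Rightarrow> (nat \<Rightarrow> 'y) measure \<Rightarrow> bool" where
  "quasi_invariant n \<pi> \<mu> \<longleftrightarrow>
    (\<forall>g\<in>carrier (braid_group n). \<forall>E\<in>sets \<mu>.
      \<pi> g ` E \<in> sets \<mu> \<and> (emeasure \<mu> E = 0 \<longleftrightarrow> emeasure \<mu> (\<pi> g ` E) = 0))"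

end

theory Submission
  imports Defs "HOL-Probability.Infinite_Product_Measure"
begin

text \<open>
  A braid generator, as well as its inverse, acts by a continuous map \<open>f\<close> of the product space
  that changes only the coordinates in a finite set \<open>J\<close>. Continuity makes \<open>f\<close> measurable: there are
  only countably many cylinders, so that every open set is a countable union of measurable ones
  (\<open>continuous_map_product_discrete_measurable\<close>).

  That the preimage of a null set \<open>E\<close> under \<open>f\<close> is a null set comes from \<open>Y\<close> being finite. If
  \<open>f x \<in> E\<close> and \<open>b\<close> is the restriction of \<open>f x\<close> to \<open>J\<close>, then \<open>f x\<close> is \<open>x\<close> with its coordinates in
  \<open>J\<close> overwritten by \<open>b\<close>. Hence the preimage is covered by the sets
  \<open>{x. x with J overwritten by b lies in E}\<close>, one for each of the finitely many \<open>b\<close>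
  (\<open>finite_coordinate_change_null_sets\<close>), and it suffices to overwrite a single coordinate \<open>j\<close> by a
  single value \<open>b\<close>. For probability measures this is Fubini's theorem: for almost every value \<open>y\<close>
  of the coordinate \<open>j\<close>, the section of \<open>E\<close> at \<open>y\<close> is null in the remaining coordinates; as \<open>b\<close> has
  positive mass, \<open>b\<close> is such a value (\<open>replace_coordinate_null_sets_prob\<close>). For finitely many
  factors of arbitrary, possibly infinite, mass, every point of the product has positive mass, so
  that only the empty set is null (\<open>null_sets_PiM_finite\<close>).

  Preservation of null sets by preimages passes to products of group elements, hence holds for the
  whole group, and the image of a set under a group element is its preimage under the inverse
  element (\<open>quasi_invariantI_preimage\<close>).
\<close>

section \<open>Induction over the braid group\<close>

lemma inv_braid_gen:
  assumes "k \<in> braid_index n"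
  shows "inv\<^bsub>braid_group n\<^esub> braid_gen n k = braid_class n [(k, False)]"
proof -
  interpret group "braid_group n" by (rule group_braid_group)
  have words: "[(k, b)] \<in> braid_words n" for b
    using assms by (simp add: braid_words_def)
  have "braid_eq n ([(k, False)] @ [(k, True)]) []"
    using braid_eq.cancel[OF assms, of False] by simp
  then have "braid_class n [(k, False)] \<otimes>\<^bsub>braid_group n\<^esub> braid_gen n k = \<one>\<^bsub>braid_group n\<^esub>"
    using words braid_class_eq_iff braid_eq_words
    by (metis braid_gen_def mult_braid_group one_braid_group)
  then show ?thesis
    using assms words by (intro inv_equality braid_gen_closed) (auto simp: carrier_braid_group)
qed

text \<open>
  As the inverses of the generators form a case of their own, a property to be proved with this
  rule may be one that does not pass to inverses, such as a property of preimages under the action.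
\<close>

lemma braid_group_induct [consumes 1, case_names one gen inv mult]:
  assumes "g \<in> carrier (braid_group n)"
    and one: "P \<one>\<^bsub>braid_group n\<^esub>"
    and gen: "\<And>k. k \<in> braid_index n \<Longrightarrow> P (braid_gen n k)"
    and inv: "\<And>k. k \<in> braid_index n \<Longrightarrow> P (inv\<^bsub>braid_group n\<^esub> braid_gen n k)"
    and mult: "\<And>g h. g \<in> carrier (braid_group n) \<Longrightarrow> h \<in> carrier (braid_group n) \<Longrightarrow>
      P g \<Longrightarrow> P h \<Longrightarrow> P (g \<otimes>\<^bsub>braid_group n\<^esub> h)"
  shows "P g"
proof -
  have "P (braid_class n w)" if "w \<in> braid_words n" for w
    using that
  proof (induction w)
    case Nil
    show ?case using one by (simp add: one_braid_group)
  next
    case (Cons x w)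
    obtain k b where x: "x = (k, b)" by (cases x)
    have k: "k \<in> braid_index n" and w: "w \<in> braid_words n"
      using Cons.prems x by (auto simp: braid_words_def)
    have letter: "[(k, b)] \<in> braid_words n"
      using k by (simp add: braid_words_def)
    have "P (braid_class n [(k, b)])"
      using gen[OF k] inv[OF k] by (cases b) (simp_all add: braid_gen_def flip: inv_braid_gen[OF k])
    then have "P (braid_class n [(k, b)] \<otimes>\<^bsub>braid_group n\<^esub> braid_class n w)"
      using Cons.IH[OF w] letter w by (intro mult) (auto simp: carrier_braid_group)
    then show ?case
      using mult_braid_group[OF letter w] x by simp
  qed
  then show ?thesis
    using assms(1) by (auto simp: carrier_braid_group)
qed

section \<open>Measurability of continuous maps\<close>

text \<open>
  The topology has a countable base that consists of measurable sets: a basic open set fixes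
  finitely many of countably many coordinates, each to one of countably many values.
\<close>

lemma openin_product_discrete_measurable:
  fixes I :: "'i set" and M :: "'i \<Rightarrow> 'y measure"
  assumes I: "countable I" and Y: "countable Y"
    and M: "\<And>i. i \<in> I \<Longrightarrow> sets (M i) = Pow Y"
    and U: "openin (product_topology (\<lambda>_. discrete_topology Y) I) U"
  shows "U \<in> sets (PiM I M)"
proof -
  have sp: "space (M i) = Y" if "i \<in> I" for i
    using M[OF that] by (metis sets_count_space sets_eq_imp_space_eq space_count_space)
  define B where "B J a = {x \<in> \<Pi>\<^sub>E i\<in>I. Y. \<forall>j\<in>J. x j = a j}" for J a
  \<comment> \<open>The indices are pairs of a finite set and an extensional function on it, instead of the sets
    \<open>B J a\<close> themselves, so that the countability of \<open>\<I>\<close> is that of a dependent sum.\<close>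
  define \<I> where "\<I> = {p \<in> (SIGMA J:{J. finite J \<and> J \<subseteq> I}. \<Pi>\<^sub>E j\<in>J. Y). B (fst p) (snd p) \<subseteq> U}"
  have B: "B J a \<in> sets (PiM I M)" if "finite J" "J \<subseteq> I" for J a
  proof -
    have "B J a = {x \<in> space (PiM I M). \<forall>j\<in>J. x j \<in> {a j} \<inter> Y}"
      using that(2) sp by (auto simp: B_def space_PiM PiE_iff)
    also have "\<dots> \<in> sets (PiM I M)"
      using that M by (intro sets.sets_Collect_finite_All sets_Collect_single) auto
    finally show ?thesis .
  qed
  have "countable {J. finite J \<and> J \<subseteq> I}"
    using countable_Collect_finite_subset[OF I] by (simp add: conj_commute)
  then have "countable (SIGMA J:{J. finite J \<and> J \<subseteq> I}. \<Pi>\<^sub>E j\<in>J. Y)"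
    using Y by (intro countable_SIGMA countable_PiE) auto
  then have "countable \<I>"
    unfolding \<I>_def by (rule countable_subset[rotated]) auto
  moreover have "U = (\<Union>p\<in>\<I>. B (fst p) (snd p))"
  proof
    show "U \<subseteq> (\<Union>p\<in>\<I>. B (fst p) (snd p))"
    proof
      fix x assume x: "x \<in> U"
      then obtain V where V: "finite {i \<in> I. V i \<noteq> Y}" "x \<in> Pi\<^sub>E I V" "Pi\<^sub>E I V \<subseteq> U"
        "\<forall>i\<in>I. V i \<subseteq> Y"
        using U unfolding openin_product_topology_alt by fastforce
      let ?J = "{i \<in> I. V i \<noteq> Y}"
      have "B ?J (restrict x ?J) \<subseteq> Pi\<^sub>E I V"
        using V(2) by (force simp: B_def PiE_iff extensional_def)
      moreover have xY: "x \<in> (\<Pi>\<^sub>E i\<in>I. Y)"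
        using V(2,4) by (auto simp: PiE_iff)
      ultimately have "(?J, restrict x ?J) \<in> \<I>"
        using V(1,3) xY by (auto simp: \<I>_def)
      moreover have "x \<in> B ?J (restrict x ?J)"
        using xY by (simp add: B_def)
      ultimately show "x \<in> (\<Union>p\<in>\<I>. B (fst p) (snd p))" by force
    qed
  qed (auto simp: \<I>_def)
  moreover have "B (fst p) (snd p) \<in> sets (PiM I M)" if "p \<in> \<I>" for p
    using that by (intro B) (auto simp: \<I>_def)
  ultimately show ?thesis
    using sets.countable_UN'[of \<I> "\<lambda>p. B (fst p) (snd p)" "PiM I M"]
    by (simp add: image_subset_iff)
qed

lemma continuous_map_product_discrete_measurable:
  fixes I :: "'i set" and M :: "'i \<Rightarrow> 'y measure"
  assumes "countable I" "countable Y"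
    and M: "\<And>i. i \<in> I \<Longrightarrow> sets (M i) = Pow Y"
    and f: "continuous_map (product_topology (\<lambda>_. discrete_topology Y) I)
      (product_topology (\<lambda>_. discrete_topology Y) I) f"
  shows "f \<in> measurable (PiM I M) (PiM I M)"
proof -
  have sp: "space (M i) = Y" if "i \<in> I" for i
    using M[OF that] by (metis sets_count_space sets_eq_imp_space_eq space_count_space)
  have X: "space (PiM I M) = (\<Pi>\<^sub>E i\<in>I. Y)"
    using sp by (auto simp: space_PiM intro!: PiE_cong)
  show ?thesis
  proof (rule measurable_PiM_single)
    show "f \<in> space (PiM I M) \<rightarrow> (\<Pi>\<^sub>E i\<in>I. space (M i))"
      using continuous_map_image_subset_topspace[OF f] X by (auto simp: space_PiM)
    fix A i assume i: "i \<in> I" and A: "A \<in> sets (M i)"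
    have "continuous_map (product_topology (\<lambda>_. discrete_topology Y) I) (discrete_topology Y)
        ((\<lambda>x. x i) \<circ> f)"
      using i by (intro continuous_map_compose[OF f] continuous_map_product_projection) auto
    then have "openin (product_topology (\<lambda>_. discrete_topology Y) I) {x \<in> \<Pi>\<^sub>E i\<in>I. Y. f x i \<in> A}"
      using openin_continuous_map_preimage[of _ "discrete_topology Y" _ A] A M[OF i] by fastforce
    then show "{x \<in> space (PiM I M). f x i \<in> A} \<in> sets (PiM I M)"
      unfolding X using assms(1,2) M by (intro openin_product_discrete_measurable[where Y = Y]) auto
  qed
qed

section \<open>Null sets and the replacement of coordinates\<close>

lemma (in prob_space) AE_atom:
  assumes "AE x in M. P x" "{b} \<in> sets M" "emeasure M {b} > 0"
  shows "P b"
proof (rule ccontr)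
  assume "\<not> P b"
  then have "AE x in M. x \<notin> {b}"
    using assms(1) by (auto elim: eventually_mono)
  then show False
    using assms(2,3) AE_iff_null_sets[of "{b}" M] by (auto simp: null_sets_def)
qed

text \<open>
  In the product of the \<open>j\<close>-th factor with the remaining ones, the set in question is a cylinder
  over the section of \<open>E\<close> at \<open>b\<close>. Fubini's theorem gives that almost all sections of \<open>E\<close> are null,
  and an almost sure property holds at the atom \<open>b\<close>. A second use of Fubini's theorem, now for a
  set whose sections do not depend on the \<open>j\<close>-th coordinate, gives the claim.
\<close>

lemma replace_coordinate_null_sets_prob:
  fixes M :: "'i \<Rightarrow> 'a measure"
  assumes M: "\<And>i. i \<in> I \<Longrightarrow> prob_space (M i)" and j: "j \<in> I"
    and b: "{b} \<in> sets (M j)" "emeasure (M j) {b} > 0"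
    and E: "E \<in> null_sets (PiM I M)"
  shows "{x \<in> space (PiM I M). x(j := b) \<in> E} \<in> null_sets (PiM I M)"
proof -
  define K where "K = I - {j}"
  have I: "I = insert j K"
    using j by (auto simp: K_def)
  interpret j: prob_space "M j" using M j .
  interpret K: prob_space "PiM K M"
    using M by (intro prob_space_PiM) (auto simp: K_def)
  interpret pair_prob_space "M j" "PiM K M" ..
  let ?P = "M j \<Otimes>\<^sub>M PiM K M"
  let ?u = "\<lambda>(y, x). x(j := y)"
  have distr: "distr ?P (PiM I M) ?u = PiM I M"
    unfolding I using M by (intro distr_pair_PiM_eq_PiM) (auto simp: K_def j)
  have meas [measurable]: "?u \<in> measurable ?P (PiM I M)"
    unfolding I by measurable
  have Es [measurable]: "E \<in> sets (PiM I M)"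
    using E by auto
  have bs: "b \<in> space (M j)"
    using sets.sets_into_space[OF b(1)] by auto
  have upd [measurable]: "(\<lambda>x. x(j := b)) \<in> measurable (PiM I M) (PiM I M)"
    using j bs by (intro measurable_fun_upd[where J = I]) auto
  have S: "{x \<in> space (PiM I M). x(j := b) \<in> E} \<in> sets (PiM I M)"
    by measurable
  have "AE x in distr ?P (PiM I M) ?u. x \<notin> E"
    unfolding distr using E by (rule AE_not_in)
  then have "AE p in ?P. ?u p \<notin> E"
    by (subst (asm) AE_distr_iff) auto
  then have "AE y in M j. AE x in PiM K M. ?u (y, x) \<notin> E"
    by (rule AE_pair)
  then have "AE x in PiM K M. ?u (b, x) \<notin> E"
    using b by (rule j.AE_atom)
  then have "AE y in M j. AE x in PiM K M. (?u (y, x))(j := b) \<notin> E"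
    by simp
  moreover have "(\<lambda>p. (?u p)(j := b)) \<in> measurable ?P (PiM I M)"
    using measurable_compose[OF meas upd] .
  then have "{p \<in> space ?P. (?u p)(j := b) \<notin> E} \<in> sets ?P"
    by measurable
  ultimately have "AE p in ?P. (?u p)(j := b) \<notin> E"
    by (intro AE_pair_measure)
  then have "AE x in distr ?P (PiM I M) ?u. x(j := b) \<notin> E"
    by (subst AE_distr_iff) auto
  then show ?thesis
    unfolding distr using S by (subst (asm) AE_iff_null) auto
qed

text \<open>
  The factors may have points of infinite mass and need not be \<open>\<sigma>\<close>-finite, so the usual construction
  of the product measure does not apply. But on a finite space the weighted counting measure \<open>N\<close>
  whose weights are the products of the point masses is a measure with the prescribed values on
  boxes, by the distributive law for sums and products in the extended nonnegative reals.
  The product measure is by definition some measure with these values, and singletons are boxes.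
\<close>

lemma emeasure_PiM_singleton_finite:
  fixes M :: "'i \<Rightarrow> 'a measure"
  assumes I: "finite I" and Y: "finite Y"
    and M: "\<And>i. i \<in> I \<Longrightarrow> sets (M i) = Pow Y"
    and x: "x \<in> (\<Pi>\<^sub>E i\<in>I. Y)"
  shows "emeasure (PiM I M) {x} = (\<Prod>i\<in>I. emeasure (M i) {x i})"
proof -
  have sp: "space (M i) = Y" if "i \<in> I" for i
    using M[OF that] by (metis sets_count_space sets_eq_imp_space_eq space_count_space)
  define X where "X = (\<Pi>\<^sub>E i\<in>I. Y)"
  have finX: "finite X"
    using I Y by (simp add: X_def finite_PiE)
  define N where "N = point_measure X (\<lambda>x. \<Prod>i\<in>I. emeasure (M i) {x i})"
  have setsN: "sets N = Pow X"
    by (simp add: N_def sets_point_measure)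
  have N: "emeasure N A = (\<Sum>x\<in>A. \<Prod>i\<in>I. emeasure (M i) {x i})" if "A \<subseteq> X" for A
    using that finX unfolding N_def by (intro emeasure_point_measure_finite2) (auto intro: finite_subset)
  have setsP: "sets (PiM I M) \<subseteq> sets N"
    using sets.space_closed[of "PiM I M"] sp by (auto simp: setsN X_def space_PiM cong: PiE_cong)
  have box: "emeasure N (\<Pi>\<^sub>E i\<in>I. A i) = (\<Prod>i\<in>I. emeasure (M i) (A i))"
    if A: "\<And>i. i \<in> I \<Longrightarrow> A i \<subseteq> Y" for A
  proof -
    have "emeasure (M i) (A i) = (\<Sum>y\<in>A i. emeasure (M i) {y})" if "i \<in> I" for i
      using that A Y M by (intro emeasure_eq_sum_singleton) (auto intro: finite_subset)
    then have "(\<Prod>i\<in>I. emeasure (M i) (A i)) = (\<Prod>i\<in>I. \<Sum>y\<in>A i. emeasure (M i) {y})"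
      by (intro prod.cong) auto
    also have "\<dots> = (\<Sum>x\<in>Pi\<^sub>E I A. \<Prod>i\<in>I. emeasure (M i) {x i})"
      using I A Y by (intro prod_sum_PiE) (auto intro: finite_subset)
    also have "\<dots> = emeasure N (\<Pi>\<^sub>E i\<in>I. A i)"
      using A by (intro N[symmetric]) (auto simp: X_def intro!: PiE_mono)
    finally show ?thesis by simp
  qed
  have "emeasure (PiM I M) (prod_emb I M I (\<Pi>\<^sub>E i\<in>I. {x i})) =
    (\<Prod>j\<in>I \<union> {i\<in>I. emeasure (M i) (space (M i)) \<noteq> 1}.
      if j \<in> I then emeasure (M j) {x j} else emeasure (M j) (space (M j)))"
  proof (rule emeasure_extend_measure_Pair[OF PiM_def, where \<mu>' = "emeasure N"])
    show "countably_additive (sets (PiM I M)) (emeasure N)"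
      using emeasure_countably_additive[of N] setsP unfolding countably_additive_def by blast
    show "positive (sets (PiM I M)) (emeasure N)"
      by (simp add: positive_def)
    show "(I \<noteq> {} \<or> I = {}) \<and> finite I \<and> I \<subseteq> I \<and> (\<lambda>i. {x i}) \<in> (\<Pi> j\<in>I. sets (M j))"
      using I x M by auto
  next
    fix J A
    assume J: "(J \<noteq> {} \<or> I = {}) \<and> finite J \<and> J \<subseteq> I \<and> A \<in> (\<Pi> j\<in>J. sets (M j))"
    show "prod_emb I M J (Pi\<^sub>E J A) \<in> Pow (\<Pi>\<^sub>E i\<in>I. space (M i))"
      by (auto simp: prod_emb_def)
    \<comment> \<open>The factors outside \<open>J\<close> of total mass 1 are missing from the prescribed value.\<close>
    let ?A = "\<lambda>i. if i \<in> J then A i else space (M i)"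
    have sub: "A j \<subseteq> Y" if "j \<in> J" for j
      using J that M by blast
    have "prod_emb I M J (Pi\<^sub>E J A) = (\<Pi>\<^sub>E i\<in>I. ?A i)"
      using J sub sp by (intro prod_emb_PiE) (simp, simp, metis subsetD)
    also have "emeasure N \<dots> = (\<Prod>i\<in>I. emeasure (M i) (?A i))"
      using sub sp by (intro box) auto
    also have "\<dots> = (\<Prod>i\<in>J \<union> {i\<in>I. emeasure (M i) (space (M i)) \<noteq> 1}. emeasure (M i) (?A i))"
      using I J by (intro prod.mono_neutral_right) auto
    also have "\<dots> = (\<Prod>j\<in>J \<union> {i\<in>I. emeasure (M i) (space (M i)) \<noteq> 1}.
        if j \<in> J then emeasure (M j) (A j) else emeasure (M j) (space (M j)))"
      by (intro prod.cong) auto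
    finally show "emeasure N (prod_emb I M J (Pi\<^sub>E J A)) = \<dots>" .
  qed
  also have "prod_emb I M I (\<Pi>\<^sub>E i\<in>I. {x i}) = {x}"
    using x sp by (subst prod_emb_id) (auto simp: PiE_singleton PiE_iff)
  also have "I \<union> {i\<in>I. emeasure (M i) (space (M i)) \<noteq> 1} = I" by auto
  finally show ?thesis by simp
qed

lemma null_sets_PiM_finite:
  fixes M :: "'i \<Rightarrow> 'a measure"
  assumes "finite I" "finite Y"
    and M: "\<And>i. i \<in> I \<Longrightarrow> sets (M i) = Pow Y"
    and pos: "\<And>i y. i \<in> I \<Longrightarrow> y \<in> Y \<Longrightarrow> emeasure (M i) {y} > 0"
    and E: "E \<in> null_sets (PiM I M)"
  shows "E = {}"
proof (rule ccontr)
  assume "E \<noteq> {}"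
  then obtain x where x: "x \<in> E" by blast
  have sp: "space (M i) = Y" if "i \<in> I" for i
    using M[OF that] by (metis sets_count_space sets_eq_imp_space_eq space_count_space)
  have xX: "x \<in> (\<Pi>\<^sub>E i\<in>I. Y)"
    using x null_setsD2[OF E, THEN sets.sets_into_space] sp by (auto simp: space_PiM PiE_iff)
  have "emeasure (PiM I M) {x} \<le> emeasure (PiM I M) E"
    using x E by (intro emeasure_mono) auto
  then have "(\<Prod>i\<in>I. emeasure (M i) {x i}) = 0"
    using E emeasure_PiM_singleton_finite[OF assms(1-3) xX] by auto
  then obtain i where "i \<in> I" "emeasure (M i) {x i} = 0"
    using assms(1) by (auto simp: prod_zero_iff)
  then show False
    using pos[of i "x i"] xX by auto
qed

text \<open>
  Up to the finitely many possible values of \<open>f\<close> on \<open>J\<close>, the map \<open>f\<close> is a replacement of the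
  coordinates in \<open>J\<close> by constants, which can be done one coordinate at a time.
\<close>

lemma finite_coordinate_change_null_sets:
  fixes M :: "('i \<Rightarrow> 'a) measure"
  assumes sp: "space M = (\<Pi>\<^sub>E i\<in>I. Y)" and Y: "finite Y" and J: "finite J" "J \<subseteq> I"
    and repl: "\<And>j b E. j \<in> I \<Longrightarrow> b \<in> Y \<Longrightarrow> E \<in> null_sets M \<Longrightarrow>
      {x \<in> space M. x(j := b) \<in> E} \<in> null_sets M"
    and f: "f \<in> measurable M M"
    and fix_off: "\<And>x i. x \<in> space M \<Longrightarrow> i \<in> I - J \<Longrightarrow> f x i = x i"
    and E: "E \<in> null_sets M"
  shows "f -` E \<inter> space M \<in> null_sets M"
proof -
  let ?S = "\<lambda>J b. {x \<in> space M. override_on x b J \<in> E}"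
  have null: "?S J b \<in> null_sets M" if "b \<in> (\<Pi>\<^sub>E j\<in>J. Y)" for b
    using J that
  proof (induction J arbitrary: b rule: finite_induct)
    case empty
    have "?S {} b = E"
      using E sets.sets_into_space[of E M] by auto
    then show ?case using E by simp
  next
    case (insert j J)
    have b: "b j \<in> Y" "restrict b J \<in> (\<Pi>\<^sub>E j\<in>J. Y)"
      using insert.prems by (auto simp: PiE_iff)
    have eq: "override_on x b (insert j J) = override_on (x(j := b j)) (restrict b J) J" for x
      using insert.hyps by (auto simp: override_on_def fun_eq_iff)
    have "?S (insert j J) b = {x \<in> space M. x(j := b j) \<in> ?S J (restrict b J)}"
      using b insert.prems unfolding eq sp by (auto simp: PiE_iff extensional_def)
    also have "\<dots> \<in> null_sets M"
      using insert b by (intro repl) auto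
    finally show ?case .
  qed
  have "f -` E \<inter> space M \<subseteq> (\<Union>b\<in>(\<Pi>\<^sub>E j\<in>J. Y). ?S J b)"
  proof
    fix x assume x: "x \<in> f -` E \<inter> space M"
    then have fx: "f x \<in> (\<Pi>\<^sub>E i\<in>I. Y)" "x \<in> (\<Pi>\<^sub>E i\<in>I. Y)"
      using measurable_space[OF f] sp by auto
    have "override_on x (restrict (f x) J) J i = f x i" for i
      using fx fix_off[of x i] x J by (cases "i \<in> I") (auto simp: override_on_def PiE_iff extensional_def)
    then have "override_on x (restrict (f x) J) J = f x" by auto
    moreover have "restrict (f x) J \<in> (\<Pi>\<^sub>E j\<in>J. Y)"
      using fx J by (auto simp: PiE_iff)
    ultimately show "x \<in> (\<Union>b\<in>(\<Pi>\<^sub>E j\<in>J. Y). ?S J b)"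
      using x by (intro UN_I[of "restrict (f x) J"]) auto
  qed
  moreover have "(\<Union>b\<in>(\<Pi>\<^sub>E j\<in>J. Y). ?S J b) \<in> null_sets M"
    using J Y null by (intro null_sets.finite_UN finite_PiE) auto
  ultimately show ?thesis
    using E measurable_sets[OF f] by (meson null_setsD2 null_sets_subset)
qed

section \<open>Quasi-invariance\<close>

lemma braid_action_inv:
  assumes act: "braid_action n Y \<pi>" and g: "g \<in> carrier (braid_group n)"
    and x: "x \<in> braid_space n Y"
  shows "\<pi> (inv\<^bsub>braid_group n\<^esub> g) (\<pi> g x) = x" "\<pi> g (\<pi> (inv\<^bsub>braid_group n\<^esub> g) x) = x"
proof -
  interpret group "braid_group n" by (rule group_braid_group)
  show "\<pi> (inv\<^bsub>braid_group n\<^esub> g) (\<pi> g x) = x" "\<pi> g (\<pi> (inv\<^bsub>braid_group n\<^esub> g) x) = x"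
    using act g x unfolding braid_action_def by (metis inv_closed l_inv r_inv)+
qed

text \<open>
  Images, which in general behave badly with respect to measurability, are preimages under the
  inverse element.
\<close>

lemma quasi_invariantI_preimage:
  assumes act: "braid_action n Y \<pi>" and sp: "space M = braid_space n Y"
    and meas: "\<And>g. g \<in> carrier (braid_group n) \<Longrightarrow> \<pi> g \<in> measurable M M"
    and null: "\<And>g E. g \<in> carrier (braid_group n) \<Longrightarrow> E \<in> null_sets M \<Longrightarrow>
      \<pi> g -` E \<inter> space M \<in> null_sets M"
  shows "quasi_invariant n \<pi> M"
  unfolding quasi_invariant_def
proof (intro ballI)
  interpret group "braid_group n" by (rule group_braid_group)
  fix g E assume g: "g \<in> carrier (braid_group n)" and E: "E \<in> sets M"
  let ?h = "inv\<^bsub>braid_group n\<^esub> g"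
  have h: "?h \<in> carrier (braid_group n)"
    using g by simp
  have EX: "E \<subseteq> space M"
    using E by (rule sets.sets_into_space)
  note inv = braid_action_inv[OF act g, folded sp]
  have image: "\<pi> g ` E = \<pi> ?h -` E \<inter> space M"
  proof (intro equalityI subsetI)
    fix x assume "x \<in> \<pi> g ` E"
    then show "x \<in> \<pi> ?h -` E \<inter> space M"
      using EX inv(1) measurable_space[OF meas[OF g]] by auto
  next
    fix x assume "x \<in> \<pi> ?h -` E \<inter> space M"
    then show "x \<in> \<pi> g ` E"
      using inv(2)[of x] by (metis IntE imageI vimageE)
  qed
  have preimage: "E = \<pi> g -` (\<pi> g ` E) \<inter> space M"
    using EX inv(1) by (auto; metis subsetD)
  have set: "\<pi> g ` E \<in> sets M"
    unfolding image using meas[OF h] E by (rule measurable_sets)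
  moreover have "E \<in> null_sets M \<longleftrightarrow> \<pi> g ` E \<in> null_sets M"
    using null[OF h, of E] null[OF g, of "\<pi> g ` E"] image preimage by auto
  ultimately show "\<pi> g ` E \<in> sets M \<and> (emeasure M E = 0 \<longleftrightarrow> emeasure M (\<pi> g ` E) = 0)"
    using E by (simp add: null_sets_def)
qed

theorem proposition5p1:
  fixes n :: enat
    and Y :: "'y set"
    and m :: "nat \<Rightarrow> 'y measure"
    and \<pi> :: "braid_word set \<Rightarrow> (nat \<Rightarrow> 'y) \<Rightarrow> (nat \<Rightarrow> 'y)"
  assumes "1 \<le> n"
    and "finite Y"
    and "\<And>k. k \<in> braid_index n \<Longrightarrow> sets (m k) = Pow Y"
    and "\<And>k y. k \<in> braid_index n \<Longrightarrow> y \<in> Y \<Longrightarrow> emeasure (m k) {y} > 0"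
    and "\<And>k. n = \<infinity> \<Longrightarrow> k \<in> braid_index n \<Longrightarrow> emeasure (m k) Y = 1"
    and "braid_action n Y \<pi>"
    and "\<And>k C. k \<in> braid_index n \<Longrightarrow> C \<in> cylinders n Y \<Longrightarrow>
      \<pi> (braid_gen n k) ` C \<in> cylinders n Y"
    and "\<And>k. k \<in> braid_index n \<Longrightarrow>
      \<exists>J. finite J \<and> J \<subseteq> braid_index n \<and>
        (\<forall>x\<in>braid_space n Y. \<forall>j\<in>braid_index n - J. \<pi> (braid_gen n k) x j = x j)"
  shows "quasi_invariant n \<pi> (PiM (braid_index n) m)"
proof -
  interpret group "braid_group n" by (rule group_braid_group)
  let ?I = "braid_index n"
  let ?\<mu> = "PiM ?I m"
  have spm: "space (m k) = Y" if "k \<in> ?I" for k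
    using assms(3)[OF that] by (metis sets_count_space sets_eq_imp_space_eq space_count_space)
  have sp: "space ?\<mu> = (\<Pi>\<^sub>E k\<in>?I. Y)"
    using spm by (auto simp: space_PiM intro!: PiE_cong)
  then have spb: "space ?\<mu> = braid_space n Y"
    by (simp add: braid_space_def)
  have meas: "\<pi> g \<in> measurable ?\<mu> ?\<mu>" if "g \<in> carrier (braid_group n)" for g
    using assms(2,3,6) that unfolding braid_action_def braid_topology_def
    by (intro continuous_map_product_discrete_measurable[where Y = Y]) (auto intro: countable_finite)
  have repl: "{x \<in> space ?\<mu>. x(j := b) \<in> E} \<in> null_sets ?\<mu>"
    if j: "j \<in> ?I" and b: "b \<in> Y" and E: "E \<in> null_sets ?\<mu>" for j b E
  proof (cases n)
    case (enat N)
    then have "finite ?I"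
      by (auto simp: braid_index_def intro: finite_subset[of _ "{..<N}"])
    then have "E = {}"
      using assms(2-4) E by (rule null_sets_PiM_finite)
    then show ?thesis by simp
  next
    case infinity
    have "prob_space (m k)" if "k \<in> ?I" for k
      using assms(5)[OF infinity that] spm[OF that] by (intro prob_spaceI) simp
    then show ?thesis
      using j b E assms(3,4) by (intro replace_coordinate_null_sets_prob) auto
  qed
  have null: "\<pi> g -` E \<inter> space ?\<mu> \<in> null_sets ?\<mu>"
    if "g \<in> carrier (braid_group n)" "E \<in> null_sets ?\<mu>" for g E
    using that
  proof (induction g arbitrary: E rule: braid_group_induct)
    case one
    have "\<pi> \<one>\<^bsub>braid_group n\<^esub> -` E \<inter> space ?\<mu> = E"
      using assms(6) sets.sets_into_space[OF null_setsD2[OF one]]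
      unfolding braid_action_def spb by (auto; metis subsetD)
    then show ?case using one by simp
  next
    case (gen k)
    obtain J where J: "finite J" "J \<subseteq> ?I"
      "\<forall>x\<in>braid_space n Y. \<forall>j\<in>?I - J. \<pi> (braid_gen n k) x j = x j"
      using assms(8)[OF gen(1)] by blast
    show ?case
      using J(3) spb gen
      by (intro finite_coordinate_change_null_sets[OF sp assms(2) J(1,2) repl meas])
        (auto simp: braid_gen_closed)
  next
    case (inv k)
    let ?g = "braid_gen n k"
    let ?h = "inv\<^bsub>braid_group n\<^esub> ?g"
    have g: "?g \<in> carrier (braid_group n)" and h: "?h \<in> carrier (braid_group n)"
      using inv(1) by (auto simp: braid_gen_closed)
    obtain J where J: "finite J" "J \<subseteq> ?I"
      "\<forall>x\<in>braid_space n Y. \<forall>j\<in>?I - J. \<pi> ?g x j = x j"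
      using assms(8)[OF inv(1)] by blast
    \<comment> \<open>The point \<open>\<pi> ?h x\<close> agrees outside \<open>J\<close> with its image under \<open>\<pi> ?g\<close>, which is \<open>x\<close>.\<close>
    have "\<pi> ?h x j = x j" if "x \<in> space ?\<mu>" "j \<in> ?I - J" for x j
      using J(3) that braid_action_inv(2)[OF assms(6) g, of x] measurable_space[OF meas[OF h], of x]
      unfolding spb by metis
    then show ?case
      using inv(2) by (intro finite_coordinate_change_null_sets[OF sp assms(2) J(1,2) repl meas[OF h]])
  next
    case (mult g h)
    have "\<pi> (g \<otimes>\<^bsub>braid_group n\<^esub> h) x = \<pi> g (\<pi> h x)" if "x \<in> space ?\<mu>" for x
      using assms(6) mult(1,2) that spb unfolding braid_action_def by blast
    then have "\<pi> (g \<otimes>\<^bsub>braid_group n\<^esub> h) -` E \<inter> space ?\<mu> =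
        \<pi> h -` (\<pi> g -` E \<inter> space ?\<mu>) \<inter> space ?\<mu>"
      using measurable_space[OF meas[OF mult(2)]] by auto
    then show ?case
      using mult.IH mult.prems by metis
  qed
  show ?thesis
    using assms(6) spb meas null by (rule quasi_invariantI_preimage)
qed

end
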